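(* The class $\mathcal{EL}(\mathcal Q_p[\bigcirc,\Diamond])$ is not polynomially characterisable; that is, there is no polynomial $f$ such that every $q\in\mathcal{EL}(\mathcal Q_p[\bigcirc,\Diamond])$ is uniquely characterised within $\mathcal{EL}(\mathcal Q_p[\bigcirc,\Diamond])$ by some example set $E$ with $|E|\le f(|q|)$.
   Context: **Data.** A (relational) data instance $\mathcal A$ is a finite set of facts $A(a)$ and $P(a,b)$ with $A$ a unary predicate symbol, $P$ a binary predicate symbol and $a,b$ individual names; $\mathrm{ind}(\mathcal A)$ is the set of individual names in it. A temporal data instance is a finite sequence $\mathcal D=\mathcal A_0,\dots,\mathcal A_n$ of data instances, with $\mathcal A_\ell=\emptyset$ for $\ell>n$; $\mathrm{ind}(\mathcal D)=\bigcup_i\mathrm{ind}(\mathcal A_i)$ and $|\mathcal D|=\sum_i|\mathcal A_i|$. **Queries.** $\mathcal Q[\bigcirc,\Diamond]\otimes\mathcal{EL}$ is the set of queries built from $\top$ and unary predicate symbols $A$ using $\wedge$, $\exists P.q$ ($P$ a binary predicate symbol), $\bigcirc q$ and $\Diamond q$. Truth: $\mathcal D,a,\ell\models A$ iff $A(a)\in\mathcal A_\ell$; $\mathcal D,a,\ell\models\exists P.q$ iff there is $b\in\mathrm{ind}(\mathcal A_\ell)$ with $P(a,b)\in\mathcal A_\ell$ and $\mathcal D,b,\ell\models q$; $\mathcal D,a,\ell\models\bigcirc q$ iff $\mathcal D,a,\ell+1\models q$; $\mathcal D,a,\ell\models\Diamond q$ iff $\mathcal D,a,m\models q$ for some $m>\ell$;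 $\top$ and $\wedge$ as usual. $\mathcal Q_p[\bigcirc,\Diamond]\otimes\mathcal{EL}$ consists of those $q$ such that for any subquery $q_1\wedge q_2$ of $q$, at least one of $q_1,q_2$ has no occurrence of $\bigcirc$ or $\Diamond$ that is not in the scope of some $\exists P$. $\mathcal{EL}(\mathcal Q_p[\bigcirc,\Diamond])$ is the class of queries in $\mathcal Q_p[\bigcirc,\Diamond]\otimes\mathcal{EL}$ that contain no $\exists P$ in the scope of a temporal operator. $|q|$ is the number of symbols in $q$; $q\equiv q'$ means that $q,q'$ are true at the same $(\mathcal D,a,\ell)$. **Characterisability.** An example set is a pair $E=(E^+,E^-)$ of finite sets of pointed temporal data instances $(\mathcal D,a)$ with $a\in\mathrm{ind}(\mathcal D)$; $|E|$ is the sum of $|\mathcal D|$ over all examples. $q$ fits $E$ if $\mathcal D,a,0\models q$ for all $(\mathcal D,a)\in E^+$ and $\mathcal D,a,0\not\models q$ for all $(\mathcal D,a)\in E^-$. $E$ uniquely characterises $q$ within $\mathcal Q$ if $q$ fits $E$ and $q\equiv q'$ for all $q'\in\mathcal Q$ fitting $E$. *)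

theory Defs
  imports "HOL-Computational_Algebra.Polynomial"
begin

text \<open>
  The sets of unary predicate symbols, binary predicate symbols and individual names are
  countably infinite, as usual in description logic; each is represented by a copy of the
  natural numbers.
\<close>

type_synonym unary = nat
type_synonym binary = nat
type_synonym ind = nat

datatype fact = UFact unary ind | BFact binary ind ind

fun fact_inds :: "fact \<Rightarrow> ind set" where
  "fact_inds (UFact A a) = {a}"
| "fact_inds (BFact P a b) = {a, b}"

definition inds :: "fact set \<Rightarrow> ind set" where
  "inds \<A> = (\<Union>\<phi>\<in>\<A>. fact_inds \<phi>)"

text \<open>
  The sequence \<open>\<A>\<^sub>0, \<dots>, \<A>\<^sub>n\<close> is a list of length \<open>n + 1\<close>. It is non-empty, but its members may
  be empty, and empty members do not contribute to the size.
\<close>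

type_synonym tdata = "fact set list"

definition temporal_data :: "tdata \<Rightarrow> bool" where
  "temporal_data \<D> \<longleftrightarrow> \<D> \<noteq> [] \<and> (\<forall>\<A>\<in>set \<D>. finite \<A>)"

definition snapshot :: "tdata \<Rightarrow> nat \<Rightarrow> fact set" where
  "snapshot \<D> l = (if l < length \<D> then \<D> ! l else {})"

definition tinds :: "tdata \<Rightarrow> ind set" where
  "tinds \<D> = (\<Union>\<A>\<in>set \<D>. inds \<A>)"

definition tdata_size :: "tdata \<Rightarrow> nat" where
  "tdata_size \<D> = (\<Sum>\<A>\<leftarrow>\<D>. card \<A>)"

text \<open>
  The datatype is the full language \<open>\<Q>[\<circle>,\<diamond>] \<otimes> \<E>\<L>\<close>.
\<close>

datatype query =
    Top
  | Atom unary
  | Conj query query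
  | Exists binary query
  | Next query
  | Diamond query

fun sat :: "tdata \<Rightarrow> ind \<Rightarrow> nat \<Rightarrow> query \<Rightarrow> bool" where
  "sat \<D> a l Top \<longleftrightarrow> True"
| "sat \<D> a l (Atom A) \<longleftrightarrow> UFact A a \<in> snapshot \<D> l"
| "sat \<D> a l (Conj q1 q2) \<longleftrightarrow> sat \<D> a l q1 \<and> sat \<D> a l q2"
| "sat \<D> a l (Exists P q) \<longleftrightarrow>
     (\<exists>b\<in>inds (snapshot \<D> l). BFact P a b \<in> snapshot \<D> l \<and> sat \<D> b l q)"
| "sat \<D> a l (Next q) \<longleftrightarrow> sat \<D> a (l + 1) q"
| "sat \<D> a l (Diamond q) \<longleftrightarrow> (\<exists>m>l. sat \<D> a m q)"

definition query_equiv :: "query \<Rightarrow> query \<Rightarrow> bool" where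
  "query_equiv q q' \<longleftrightarrow> (\<forall>\<D> a l. temporal_data \<D> \<longrightarrow> (sat \<D> a l q \<longleftrightarrow> sat \<D> a l q'))"

text \<open>
  The two symbols in \<open>\<exists>P\<close> are counted separately; parentheses are not counted.
\<close>

fun query_size :: "query \<Rightarrow> nat" where
  "query_size Top = 1"
| "query_size (Atom A) = 1"
| "query_size (Conj q1 q2) = query_size q1 + query_size q2 + 1"
| "query_size (Exists P q) = query_size q + 2"
| "query_size (Next q) = query_size q + 1"
| "query_size (Diamond q) = query_size q + 1"

fun subqueries :: "query \<Rightarrow> query set" where
  "subqueries Top = {Top}"
| "subqueries (Atom A) = {Atom A}"
| "subqueries (Conj q1 q2) = {Conj q1 q2} \<union> subqueries q1 \<union> subqueries q2"
| "subqueries (Exists P q) = {Exists P q} \<union> subqueries q"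
| "subqueries (Next q) = {Next q} \<union> subqueries q"
| "subqueries (Diamond q) = {Diamond q} \<union> subqueries q"

text \<open>
  Whether some temporal operator occurs outside the scope of every \<open>\<exists>P\<close>.
\<close>

fun unguarded_temporal :: "query \<Rightarrow> bool" where
  "unguarded_temporal Top \<longleftrightarrow> False"
| "unguarded_temporal (Atom A) \<longleftrightarrow> False"
| "unguarded_temporal (Conj q1 q2) \<longleftrightarrow> unguarded_temporal q1 \<or> unguarded_temporal q2"
| "unguarded_temporal (Exists P q) \<longleftrightarrow> False"
| "unguarded_temporal (Next q) \<longleftrightarrow> True"
| "unguarded_temporal (Diamond q) \<longleftrightarrow> True"

text \<open>\<open>\<Q>\<^sub>p[\<circle>,\<diamond>] \<otimes> \<E>\<L>\<close>\<close>

definition Qp_EL :: "query set" where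
  "Qp_EL = {q. \<forall>q1 q2. Conj q1 q2 \<in> subqueries q \<longrightarrow>
                 \<not> unguarded_temporal q1 \<or> \<not> unguarded_temporal q2}"

text \<open>\<open>\<E>\<L>(\<Q>\<^sub>p[\<circle>,\<diamond>])\<close>\<close>

definition EL_Qp :: "query set" where
  "EL_Qp = {q \<in> Qp_EL. \<forall>r. Next r \<in> subqueries q \<or> Diamond r \<in> subqueries q \<longrightarrow>
                 (\<forall>P s. Exists P s \<notin> subqueries r)}"

type_synonym example = "tdata \<times> ind"

definition pointed_data :: "example \<Rightarrow> bool" where
  "pointed_data e \<longleftrightarrow> temporal_data (fst e) \<and> snd e \<in> tinds (fst e)"

type_synonym examples = "example set \<times> example set"

definition example_set :: "examples \<Rightarrow> bool" where
  "example_set E \<longleftrightarrow> finite (fst E) \<and> finite (snd E) \<and> (\<forall>e\<in>fst E \<union> snd E. pointed_data e)"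

definition examples_size :: "examples \<Rightarrow> nat" where
  "examples_size E = (\<Sum>e\<in>fst E. tdata_size (fst e)) + (\<Sum>e\<in>snd E. tdata_size (fst e))"

definition fits :: "query \<Rightarrow> examples \<Rightarrow> bool" where
  "fits q E \<longleftrightarrow> (\<forall>(\<D>, a)\<in>fst E. sat \<D> a 0 q) \<and> (\<forall>(\<D>, a)\<in>snd E. \<not> sat \<D> a 0 q)"

definition uniquely_characterises :: "examples \<Rightarrow> query \<Rightarrow> query set \<Rightarrow> bool" where
  "uniquely_characterises E q \<Q> \<longleftrightarrow> fits q E \<and> (\<forall>q'\<in>\<Q>. fits q' E \<longrightarrow> query_equiv q q')"

definition polynomially_characterisable :: "query set \<Rightarrow> bool" where
  "polynomially_characterisable \<Q> \<longleftrightarrow>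
     (\<exists>f :: real poly. \<forall>q\<in>\<Q>. \<exists>E. example_set E \<and> uniquely_characterises E q \<Q> \<and>
        real (examples_size E) \<le> poly f (real (query_size q)))"

end

theory Submission
  imports Defs "HOL-Real_Asymp.Real_Asymp"
begin

text \<open>
  Over the time line, the pattern \<open>A \<and> \<diamond>B\<close> is the disjunction of \<open>A \<and> \<circle>B\<close> and \<open>A \<and> \<diamond>\<diamond>B\<close>, while
  \<open>A \<and> \<circle>(B \<and> \<circle>B)\<close> implies both. For \<open>i < n\<close> let \<open>r\<^sub>i\<close> be the path query with \<open>n\<close> blocks, over pairwise
  different predicates, whose \<open>i\<close>-th block is of the first kind and whose other blocks are of the last
  kind, and let \<open>q = \<exists>P.r\<^sub>0 \<and> \<dots> \<and> \<exists>P.r\<^sub>n\<^sub>-\<^sub>1\<close>. For \<open>\<sigma> \<subseteq> {0, \<dots>, n - 1}\<close> let \<open>x\<^sub>\<sigma>\<close> be the path query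
  whose \<open>i\<close>-th block is \<open>A \<and> \<circle>B\<close> or \<open>A \<and> \<diamond>\<diamond>B\<close> depending on whether \<open>i \<in> \<sigma>\<close>. The query
  \<open>q \<and> \<exists>P.x\<^sub>\<sigma>\<close> is strictly stronger than \<open>q\<close>, so it has to be rejected by a positive example. In a model of
  \<open>q\<close>, the witness of \<open>\<exists>P.r\<^sub>i\<close> satisfies \<open>x\<^sub>\<sigma>\<close> for all \<open>\<sigma>\<close> containing \<open>i\<close> or for all \<open>\<sigma>\<close> not containing
  \<open>i\<close>. Hence a positive example rejects at most one of these queries, and \<open>2\<^sup>n\<close> positive examples are
  needed, although the size of \<open>q\<close> is quadratic in \<open>n\<close>.
\<close>

section \<open>Path queries made of blocks\<close>

fun loose :: "nat set \<Rightarrow> nat \<Rightarrow> query" where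
  "loose F 0 = Top"
| "loose F (Suc n) = Diamond (Conj (Atom (2 * n))
     (if n \<in> F then Diamond (Conj (Atom (2 * n + 1)) (loose F n))
      else Next (Conj (Atom (2 * n + 1)) (Next (Conj (Atom (2 * n + 1)) (loose F n))))))"

text \<open>This is \<open>x\<^sub>\<sigma>\<close>, and \<open>loose {i} n\<close> is
  \<open>r\<^sub>i\<close>; in both, time runs through the blocks from \<open>n - 1\<close> down to
  \<open>0\<close>.\<close>

fun exact :: "nat set \<Rightarrow> nat \<Rightarrow> query" where
  "exact \<sigma> 0 = Top"
| "exact \<sigma> (Suc n) = Diamond (Conj (Atom (2 * n))
     (if n \<in> \<sigma> then Next (Conj (Atom (2 * n + 1)) (exact \<sigma> n))
      else Diamond (Diamond (Conj (Atom (2 * n + 1)) (exact \<sigma> n)))))"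

fun conj_all :: "query list \<Rightarrow> query" where
  "conj_all [] = Top"
| "conj_all (q # qs) = Conj q (conj_all qs)"

definition loose_conj :: "nat \<Rightarrow> query" where
  "loose_conj n = conj_all (map (\<lambda>i. Exists 0 (loose {i} n)) [0..<n])"

lemma sat_conj_all: "sat \<D> a l (conj_all qs) \<longleftrightarrow> (\<forall>q\<in>set qs. sat \<D> a l q)"
  by (induction qs) auto

lemma sat_Exists: "sat \<D> a l (Exists P q) \<longleftrightarrow> (\<exists>b. BFact P a b \<in> snapshot \<D> l \<and> sat \<D> b l q)"
  by (force simp: inds_def)

lemma sat_loose_conj:
  "sat \<D> a l (loose_conj n) \<longleftrightarrow>
     (\<forall>i<n. \<exists>b. BFact 0 a b \<in> snapshot \<D> l \<and> sat \<D> b l (loose {i} n))"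
  by (auto simp: loose_conj_def sat_conj_all sat_Exists simp del: sat.simps(4))

lemma sat_exact_antimono: "sat \<D> a m (exact \<sigma> n) \<Longrightarrow> l \<le> m \<Longrightarrow> sat \<D> a l (exact \<sigma> n)"
  by (cases n) (auto intro: le_less_trans)

text \<open>\<open>T\<close> collects the blocks of \<open>F\<close> whose two atoms are matched at
  adjacent time points. A block outside \<open>F\<close> supports both choices, so only membership
  in \<open>F\<close> constrains \<sigma>.\<close>

lemma sat_loose_imp_exact:
  assumes "sat \<D> a l (loose F n)"
  shows "\<exists>T. \<forall>\<sigma>. (\<forall>i\<in>F. i < n \<longrightarrow> (i \<in> \<sigma> \<longleftrightarrow> i \<in> T)) \<longrightarrow> sat \<D> a l (exact \<sigma> n)"
  using assms
proof (induction n arbitrary: l)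
  case 0
  show ?case by simp
next
  case (Suc n)
  show ?case
  proof (cases "n \<in> F")
    case True
    with Suc.prems obtain m k where mk: "l < m" "m < k" "sat \<D> a m (Atom (2 * n))"
      "sat \<D> a k (Atom (2 * n + 1))" "sat \<D> a k (loose F n)" by auto
    from Suc.IH[OF mk(5)] obtain T where
      T: "\<And>\<sigma>. (\<forall>i\<in>F. i < n \<longrightarrow> (i \<in> \<sigma> \<longleftrightarrow> i \<in> T)) \<Longrightarrow> sat \<D> a k (exact \<sigma> n)" by blast
    define T' where "T' = (if k = Suc m then insert n T else T - {n})"
    have "sat \<D> a l (exact \<sigma> (Suc n))" if "\<forall>i\<in>F. i < Suc n \<longrightarrow> (i \<in> \<sigma> \<longleftrightarrow> i \<in> T')" for \<sigma>
    proof -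
      have "\<forall>i\<in>F. i < n \<longrightarrow> (i \<in> \<sigma> \<longleftrightarrow> i \<in> T)" using that by (auto simp: T'_def split: if_splits)
      with T have sk: "sat \<D> a k (exact \<sigma> n)" by blast
      have n: "n \<in> \<sigma> \<longleftrightarrow> k = Suc m" using that True by (auto simp: T'_def)
      show ?thesis
      proof (cases "n \<in> \<sigma>")
        case True
        then show ?thesis using n sk mk by auto
      next
        case False
        with n mk(2) have "m < Suc m" "Suc m < k" by auto
        then show ?thesis using False sk mk by auto
      qed
    qed
    then show ?thesis by blast
  next
    case False
    with Suc.prems obtain m where m: "l < m" "sat \<D> a m (Atom (2 * n))"
      "sat \<D> a (Suc m) (Atom (2 * n + 1))" "sat \<D> a (Suc (Suc m)) (Atom (2 * n + 1))"
      "sat \<D> a (Suc (Suc m)) (loose F n)" by auto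
    from Suc.IH[OF m(5)] obtain T where
      T: "\<And>\<sigma>. (\<forall>i\<in>F. i < n \<longrightarrow> (i \<in> \<sigma> \<longleftrightarrow> i \<in> T)) \<Longrightarrow> sat \<D> a (Suc (Suc m)) (exact \<sigma> n)" by blast
    have "sat \<D> a l (exact \<sigma> (Suc n))" if "\<forall>i\<in>F. i < Suc n \<longrightarrow> (i \<in> \<sigma> \<longleftrightarrow> i \<in> T)" for \<sigma>
    proof -
      \<comment> \<open>If \<open>n \<in> \<sigma>\<close>, the block ends at its first B, and the
        rest, which starts with a diamond, is moved back to \<open>Suc m\<close>; otherwise the
        second B is used.\<close>
      have s: "sat \<D> a (Suc (Suc m)) (exact \<sigma> n)" using that T by simp
      then have s': "sat \<D> a (Suc m) (exact \<sigma> n)" by (rule sat_exact_antimono) simp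
      have "m < Suc m" "Suc m < Suc (Suc m)" by auto
      then show ?thesis using s s' m by auto
    qed
    then show ?thesis by blast
  qed
qed

lemma sat_exact_imp_distance:
  assumes "sat \<D> a l (exact \<sigma> n)" "i < n"
  shows "\<exists>m k. m < k \<and> UFact (2 * i) a \<in> snapshot \<D> m \<and> UFact (2 * i + 1) a \<in> snapshot \<D> k \<and>
           (i \<in> \<sigma> \<longleftrightarrow> k = Suc m)"
  using assms
proof (induction n arbitrary: l)
  case 0
  then show ?case by simp
next
  case (Suc n)
  show ?case
  proof (cases "i = n")
    case True
    from Suc.prems(1) obtain m where m: "UFact (2 * n) a \<in> snapshot \<D> m"
      "if n \<in> \<sigma> then UFact (2 * n + 1) a \<in> snapshot \<D> (Suc m)
       else \<exists>j>m. \<exists>k>j. UFact (2 * n + 1) a \<in> snapshot \<D> k" by (auto split: if_splits)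
    show ?thesis
    proof (cases "n \<in> \<sigma>")
      case True
      with m \<open>i = n\<close> show ?thesis by auto
    next
      case False
      with m(2) obtain j k where "j > m" "k > j" "UFact (2 * n + 1) a \<in> snapshot \<D> k" by auto
      then have "m < k" "k \<noteq> Suc m" "UFact (2 * n + 1) a \<in> snapshot \<D> k" by auto
      with m(1) False \<open>i = n\<close> show ?thesis by blast
    qed
  next
    case False
    from Suc.prems(1) have "\<exists>l. sat \<D> a l (exact \<sigma> n)" by (auto split: if_splits)
    with Suc.IH False Suc.prems(2) show ?thesis by auto
  qed
qed

section \<open>Data separating the strengthened queries\<close>

text \<open>
  The individual \<open>i + 1\<close> is the witness of \<open>\<exists>P.r\<^sub>i\<close>. Block \<open>j\<close> occupies the time points from
  \<open>3 * (n - j)\<close> to \<open>3 * (n - j) + 2\<close>, and the distance in the \<open>i\<close>-th block is the one excluded by \<open>x\<^sub>\<sigma>\<close>.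
\<close>

definition sep_snapshot :: "nat set \<Rightarrow> nat \<Rightarrow> nat \<Rightarrow> fact set" where
  "sep_snapshot \<sigma> n l =
     {BFact 0 0 (Suc i) |i. i < n \<and> l = 0} \<union>
     {UFact (2 * j) (Suc i) |i j. i < n \<and> j < n \<and> l = 3 * (n - j)} \<union>
     {UFact (2 * j + 1) (Suc i) |i j. i < n \<and> j < n \<and>
        (l = 3 * (n - j) + 1 \<and> (i = j \<longrightarrow> i \<notin> \<sigma>) \<or> l = 3 * (n - j) + 2 \<and> (i = j \<longrightarrow> i \<in> \<sigma>))}"

definition sep_data :: "nat set \<Rightarrow> nat \<Rightarrow> tdata" where
  \<comment> \<open>Block \<open>0\<close> is the last one and ends at time
    \<open>3 * n + 2\<close>.\<close>
  "sep_data \<sigma> n = map (sep_snapshot \<sigma> n) [0..<3 * n + 3]"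

lemma finite_sep_snapshot: "finite (sep_snapshot \<sigma> n l)"
proof (rule finite_subset)
  show "sep_snapshot \<sigma> n l \<subseteq> (\<lambda>i. BFact 0 0 (Suc i)) ` {..<n} \<union>
    (\<lambda>(i, j). UFact (2 * j) (Suc i)) ` ({..<n} \<times> {..<n}) \<union>
    (\<lambda>(i, j). UFact (2 * j + 1) (Suc i)) ` ({..<n} \<times> {..<n})"
    by (auto simp: sep_snapshot_def)
qed auto

lemma temporal_data_sep_data: "temporal_data (sep_data \<sigma> n)"
  by (auto simp: temporal_data_def sep_data_def finite_sep_snapshot)

lemma snapshot_sep_data: "snapshot (sep_data \<sigma> n) l = sep_snapshot \<sigma> n l"
  by (auto simp: snapshot_def sep_data_def sep_snapshot_def)

lemma BFact_sep_snapshot: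
  "BFact P a b \<in> sep_snapshot \<sigma> n l \<longleftrightarrow> P = 0 \<and> a = 0 \<and> l = 0 \<and> (\<exists>i<n. b = Suc i)"
  by (auto simp: sep_snapshot_def)

lemma UFact_sep_snapshot_even:
  "UFact (2 * j) (Suc i) \<in> sep_snapshot \<sigma> n l \<longleftrightarrow> i < n \<and> j < n \<and> l = 3 * (n - j)"
  by (auto simp: sep_snapshot_def double_not_eq_Suc_double Suc_double_not_eq_double)

lemma UFact_sep_snapshot_odd:
  "UFact (Suc (2 * j)) (Suc i) \<in> sep_snapshot \<sigma> n l \<longleftrightarrow> i < n \<and> j < n \<and>
     (l = 3 * (n - j) + 1 \<and> (i = j \<longrightarrow> i \<notin> \<sigma>) \<or> l = 3 * (n - j) + 2 \<and> (i = j \<longrightarrow> i \<in> \<sigma>))"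
  by (auto simp: sep_snapshot_def double_not_eq_Suc_double Suc_double_not_eq_double)

text \<open>The bound on \<open>l\<close> is the end of block \<open>k\<close>, just before block
  \<open>k - 1\<close> starts, so the next diamond can still reach that start.\<close>

lemma sat_loose_sep_data:
  assumes "i < n" "k \<le> n" "l \<le> 3 * (n - k) + 2"
  shows "sat (sep_data \<sigma> n) (Suc i) l (loose {i} k)"
  using assms(2,3)
proof (induction k arbitrary: l)
  case 0
  show ?case by simp
next
  case (Suc k)
  define p where "p = 3 * (n - k)"
  have p: "l < p" using Suc.prems by (auto simp: p_def)
  have A: "UFact (2 * k) (Suc i) \<in> sep_snapshot \<sigma> n p"
    using Suc.prems assms by (auto simp: UFact_sep_snapshot_even p_def)
  have IH: "sat (sep_data \<sigma> n) (Suc i) m (loose {i} k)" if "m \<le> p + 2" for m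
    using Suc.IH Suc.prems(1) that by (auto simp: p_def)
  show ?case
  proof (cases "k = i")
    case True
    define m where "m = (if i \<in> \<sigma> then p + 2 else p + 1)"
    have "m > p" "m \<le> p + 2" "UFact (Suc (2 * k)) (Suc i) \<in> sep_snapshot \<sigma> n m"
      using Suc.prems assms True by (auto simp: UFact_sep_snapshot_odd p_def m_def)
    with True p A IH[of m] show ?thesis by (auto simp: snapshot_sep_data)
  next
    case False
    then have "UFact (Suc (2 * k)) (Suc i) \<in> sep_snapshot \<sigma> n (Suc p)"
      "UFact (Suc (2 * k)) (Suc i) \<in> sep_snapshot \<sigma> n (Suc (Suc p))"
      using Suc.prems assms by (auto simp: UFact_sep_snapshot_odd p_def)
    with False p A IH[of "Suc (Suc p)"] show ?thesis by (auto simp: snapshot_sep_data)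
  qed
qed

lemma sat_loose_conj_sep_data: "sat (sep_data \<sigma> n) 0 0 (loose_conj n)"
  by (auto simp: sat_loose_conj snapshot_sep_data BFact_sep_snapshot intro!: sat_loose_sep_data)

lemma not_sat_exact_sep_data: "\<not> sat (sep_data \<sigma> n) 0 0 (Exists 0 (exact \<sigma> n))"
proof
  assume "sat (sep_data \<sigma> n) 0 0 (Exists 0 (exact \<sigma> n))"
  then obtain i where i: "i < n" "sat (sep_data \<sigma> n) (Suc i) 0 (exact \<sigma> n)"
    by (auto simp: snapshot_sep_data BFact_sep_snapshot)
  from sat_exact_imp_distance[OF i(2,1)] show False
    by (auto simp: snapshot_sep_data UFact_sep_snapshot_even UFact_sep_snapshot_odd)
qed

lemma not_equiv_strengthening:
  "\<not> query_equiv (loose_conj n) (Conj (loose_conj n) (Exists 0 (exact \<sigma> n)))"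
  using sat_loose_conj_sep_data[of \<sigma> n] not_sat_exact_sep_data[of \<sigma> n] temporal_data_sep_data[of \<sigma> n]
  by (auto simp: query_equiv_def simp del: sat.simps(4))

section \<open>Membership in the class and query size\<close>

lemma Exists_notin_loose: "Exists P s \<notin> subqueries (loose F n)"
  by (induction n) auto

lemma Exists_notin_exact: "Exists P s \<notin> subqueries (exact \<sigma> n)"
  by (induction n) auto

lemma subqueries_trans: "r \<in> subqueries s \<Longrightarrow> s \<in> subqueries q \<Longrightarrow> r \<in> subqueries q"
  by (induction q) auto

lemma Exists_in_EL_Qp:
  assumes "q \<in> Qp_EL" "\<And>P s. Exists P s \<notin> subqueries q"
  shows "Exists P q \<in> EL_Qp"
proof -
  have "Exists P' s \<notin> subqueries r"
    if "Next r \<in> subqueries q \<or> Diamond r \<in> subqueries q" for r P' s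
  proof
    assume "Exists P' s \<in> subqueries r"
    then have "Exists P' s \<in> subqueries (Next r)" "Exists P' s \<in> subqueries (Diamond r)" by auto
    with that assms(2) show False by (metis subqueries_trans)
  qed
  with assms(1) show ?thesis by (simp add: EL_Qp_def Qp_EL_def)
qed

lemma loose_in_Qp_EL: "loose F n \<in> Qp_EL"
  by (induction n) (auto simp: Qp_EL_def)

lemma exact_in_Qp_EL: "exact \<sigma> n \<in> Qp_EL"
  by (induction n) (auto simp: Qp_EL_def)

lemma Conj_in_EL_Qp:
  assumes "q \<in> EL_Qp" "r \<in> EL_Qp" "\<not> unguarded_temporal q \<or> \<not> unguarded_temporal r"
  shows "Conj q r \<in> EL_Qp"
  using assms by (auto simp: EL_Qp_def Qp_EL_def)

lemma conj_all_in_EL_Qp: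
  "(\<And>q. q \<in> set qs \<Longrightarrow> q \<in> EL_Qp \<and> \<not> unguarded_temporal q) \<Longrightarrow> conj_all qs \<in> EL_Qp"
proof (induction qs)
  case Nil
  show ?case by (simp add: EL_Qp_def Qp_EL_def)
next
  case (Cons q qs)
  then show ?case by (simp add: Conj_in_EL_Qp)
qed

lemma loose_conj_in_EL_Qp: "loose_conj n \<in> EL_Qp"
  unfolding loose_conj_def
  by (rule conj_all_in_EL_Qp) (auto intro: Exists_in_EL_Qp loose_in_Qp_EL simp: Exists_notin_loose)

lemma strengthening_in_EL_Qp: "Conj (loose_conj n) (Exists 0 (exact \<sigma> n)) \<in> EL_Qp"
  by (auto intro!: Conj_in_EL_Qp loose_conj_in_EL_Qp Exists_in_EL_Qp exact_in_Qp_EL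
      simp: Exists_notin_exact)

lemma query_size_loose_conj: "query_size (loose_conj n) \<le> 13 * (n + 1)\<^sup>2"
proof -
  \<comment> \<open>Nine symbols are spent on a block outside \<open>F\<close>, fewer on one in
    \<open>F\<close>.\<close>
  have *: "query_size (loose F k) \<le> 9 * k + 1" for F k
    by (induction k) auto
  have "query_size (conj_all (map (\<lambda>i. Exists 0 (loose {i} n)) xs)) \<le> (9 * n + 4) * length xs + 1"
    for xs
  proof (induction xs)
    case (Cons i xs)
    then show ?case using *[of "{i}" n] by simp
  qed simp
  from this[of "[0..<n]"] have "query_size (loose_conj n) \<le> (9 * n + 4) * n + 1"
    by (simp add: loose_conj_def)
  also have "\<dots> \<le> 13 * (n + 1)\<^sup>2"
    by (simp add: power2_eq_square algebra_simps)
  finally show ?thesis .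
qed

section \<open>Counting positive examples\<close>

lemma tdata_size_pos:
  assumes "pointed_data e"
  shows "tdata_size (fst e) \<ge> 1"
proof -
  \<comment> \<open>The distinguished individual occurs in some fact.\<close>
  from assms obtain \<A> where \<A>: "\<A> \<in> set (fst e)" "\<A> \<noteq> {}" "finite \<A>"
    by (auto simp: pointed_data_def temporal_data_def tinds_def inds_def)
  then have "1 \<le> card \<A>" by (simp add: Suc_le_eq card_gt_0_iff)
  also have "\<dots> \<le> tdata_size (fst e)"
    unfolding tdata_size_def using \<A>(1) by (intro member_le_sum_list) auto
  finally show ?thesis .
qed

lemma card_positive_le_examples_size:
  assumes "example_set E"
  shows "card (fst E) \<le> examples_size E"
proof -
  have "card (fst E) = (\<Sum>e\<in>fst E. 1)" by simp
  also have "\<dots> \<le> (\<Sum>e\<in>fst E. tdata_size (fst e))"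
    using assms by (intro sum_mono tdata_size_pos) (auto simp: example_set_def)
  finally show ?thesis by (simp add: examples_size_def)
qed

text \<open>If the two sets differed at \<open>i\<close>, one of them would agree there with the
  choice made by the witness of \<open>r\<^sub>i\<close>, and that witness would satisfy its
  query.\<close>

lemma rejected_choice_unique:
  assumes q: "sat \<D> a l (loose_conj n)"
    and "\<sigma> \<subseteq> {..<n}" "\<not> sat \<D> a l (Exists 0 (exact \<sigma> n))"
    and "\<sigma>' \<subseteq> {..<n}" "\<not> sat \<D> a l (Exists 0 (exact \<sigma>' n))"
  shows "\<sigma> = \<sigma>'"
proof -
  have "i \<in> \<sigma> \<longleftrightarrow> i \<in> \<sigma>'" if "i < n" for i
  proof -
    from q that obtain b where b: "BFact 0 a b \<in> snapshot \<D> l" "sat \<D> b l (loose {i} n)"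
      by (auto simp: sat_loose_conj)
    from sat_loose_imp_exact[OF b(2)] obtain T where
      "\<And>\<tau>. (i \<in> \<tau> \<longleftrightarrow> i \<in> T) \<Longrightarrow> sat \<D> b l (exact \<tau> n)" by auto
    with b(1) assms(3,5) show ?thesis unfolding sat_Exists by blast
  qed
  with assms(2,4) show ?thesis by blast
qed

lemma characterisation_lower_bound:
  assumes E: "example_set E" and char: "uniquely_characterises E (loose_conj n) EL_Qp"
  shows "2 ^ n \<le> examples_size E"
proof -
  define rejects where
    "rejects e \<sigma> \<longleftrightarrow> \<not> sat (fst e) (snd e) 0 (Exists 0 (exact \<sigma> n))" for e :: example and \<sigma>
  have fit: "fits (loose_conj n) E" using char by (simp add: uniquely_characterises_def)
  \<comment> \<open>Negative examples already reject the weaker query, so only a positive one can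
    rule out the strengthening.\<close>
  have "\<exists>e\<in>fst E. rejects e \<sigma>" for \<sigma>
  proof (rule ccontr)
    assume "\<not> ?thesis"
    then have "fits (Conj (loose_conj n) (Exists 0 (exact \<sigma> n))) E"
      using fit by (fastforce simp: fits_def rejects_def simp del: sat.simps(4))
    with char strengthening_in_EL_Qp not_equiv_strengthening show False
      by (auto simp: uniquely_characterises_def)
  qed
  then obtain g where g: "\<And>\<sigma>. g \<sigma> \<in> fst E" "\<And>\<sigma>. rejects (g \<sigma>) \<sigma>" by metis
  have "inj_on g (Pow {..<n})"
  proof (rule inj_onI)
    fix \<sigma> \<sigma>' assume *: "\<sigma> \<in> Pow {..<n}" "\<sigma>' \<in> Pow {..<n}" "g \<sigma> = g \<sigma>'"
    have "sat (fst (g \<sigma>)) (snd (g \<sigma>)) 0 (loose_conj n)"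
      using fit g(1)[of \<sigma>] by (auto simp: fits_def)
    then show "\<sigma> = \<sigma>'"
      by (rule rejected_choice_unique)
        (use * g(2)[of \<sigma>] g(2)[of \<sigma>'] in \<open>auto simp: rejects_def simp del: sat.simps(4)\<close>)
  qed
  then have "card (Pow {..<n}) \<le> card (fst E)"
    using g(1) E by (intro card_inj_on_le[of g]) (auto simp: example_set_def)
  also have "\<dots> \<le> examples_size E" by (rule card_positive_le_examples_size[OF E])
  finally show ?thesis by (simp add: card_Pow)
qed

section \<open>Polynomial against exponential growth\<close>

lemma poly_le_monomial:
  fixes f :: "real poly"
  shows "\<exists>C d. C \<ge> 0 \<and> (\<forall>x\<ge>1. poly f x \<le> C * x ^ d)"
proof (induction f)
  case 0
  show ?case by (rule exI[of _ 0]) auto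
next
  case (pCons a f)
  then obtain C d where C: "C \<ge> 0" "\<And>x. x \<ge> 1 \<Longrightarrow> poly f x \<le> C * x ^ d" by blast
  have "poly (pCons a f) x \<le> (\<bar>a\<bar> + C) * x ^ Suc d" if "x \<ge> 1" for x
  proof -
    have "x * poly f x \<le> x * (C * x ^ d)" using C(2)[OF that] that by (intro mult_left_mono) auto
    moreover have "a \<le> \<bar>a\<bar> * x ^ Suc d"
      using mult_left_mono[OF one_le_power[OF that, of "Suc d"], of "\<bar>a\<bar>"] by simp
    ultimately show ?thesis by (simp add: algebra_simps)
  qed
  with C(1) show ?case by (intro exI[of _ "\<bar>a\<bar> + C"] exI[of _ "Suc d"]) auto
qed

lemma monomial_less_power_two:
  fixes C :: real
  shows "\<exists>n::nat. C * (13 * (real n + 1)\<^sup>2) ^ d < 2 ^ n"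
proof -
  have "(\<lambda>n::nat. C * (13 * (real n + 1)\<^sup>2) ^ d / 2 ^ n) \<longlonglongrightarrow> 0"
    by real_asymp
  then have "eventually (\<lambda>n::nat. C * (13 * (real n + 1)\<^sup>2) ^ d / 2 ^ n < 1) sequentially"
    by (rule order_tendstoD) simp
  then obtain n :: nat where "C * (13 * (real n + 1)\<^sup>2) ^ d / 2 ^ n < 1"
    by (auto dest: eventually_happens)
  then show ?thesis by (auto simp: field_simps)
qed

theorem theorem26: "\<not> polynomially_characterisable EL_Qp"
proof
  assume "polynomially_characterisable EL_Qp"
  then obtain f :: "real poly" where f: "\<And>q. q \<in> EL_Qp \<Longrightarrow> \<exists>E. example_set E \<and>
      uniquely_characterises E q EL_Qp \<and> real (examples_size E) \<le> poly f (real (query_size q))"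
    unfolding polynomially_characterisable_def by blast
  \<comment> \<open>The query size is only bounded from above and \<open>f\<close> may fail to be
    monotone, so a monotone bound replaces it.\<close>
  obtain C d where C: "C \<ge> 0" "\<And>x. x \<ge> 1 \<Longrightarrow> poly f x \<le> C * x ^ d"
    using poly_le_monomial by blast
  obtain n where n: "C * (13 * (real n + 1)\<^sup>2) ^ d < 2 ^ n"
    using monomial_less_power_two by blast
  define s where "s = query_size (loose_conj n)"
  obtain E where E: "example_set E" "uniquely_characterises E (loose_conj n) EL_Qp"
      "real (examples_size E) \<le> poly f (real s)"
    using f[OF loose_conj_in_EL_Qp] unfolding s_def by blast
  have s: "1 \<le> s" unfolding s_def by (cases "loose_conj n") auto
  have "real s \<le> real (13 * (n + 1)\<^sup>2)"
    unfolding s_def using query_size_loose_conj by (rule of_nat_mono)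
  then have s': "real s \<le> 13 * (real n + 1)\<^sup>2" by (simp add: add.commute)
  have "(2::real) ^ n \<le> real (examples_size E)"
    using characterisation_lower_bound[OF E(1,2)] of_nat_mono by fastforce
  also have "\<dots> \<le> C * real s ^ d" using E(3) C(2)[of "real s"] s by simp
  also have "\<dots> \<le> C * (13 * (real n + 1)\<^sup>2) ^ d"
    using C(1) s' by (intro mult_left_mono power_mono) auto
  also have "\<dots> < 2 ^ n" by (rule n)
  finally show False by simp
qed

end
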